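(* Let $\mathcal{A}$, $\mathcal{P}_{\mathcal{T}}$, $\mathbf{S}$ and the nonsingular matrix $\widehat{\mathbf{S}}$ be as defined in the context. Then the eigenvalues of $\mathcal{P}_{\mathcal{T}}^{-1}\mathcal{A}$, counted with algebraic multiplicity, are given by $(s+p)(N+1)$ units, and the remaining $s(N+1)$ eigenvalues are given by the eigenvalues of $\mathbf{S}\widehat{\mathbf{S}}^{-1}$.
   Context: $N,s,p\ge1$ are integers. $B,Q_1,\dots,Q_N\in\mathbb{R}^{s\times s}$ and $R_0,\dots,R_N\in\mathbb{R}^{p\times p}$ are symmetric positive definite, $H_0,\dots,H_N\in\mathbb{R}^{p\times s}$, $M\in\mathbb{R}^{s\times s}$. $\mathbf{D}=\mathrm{blkdiag}(B,Q_1,\dots,Q_N)$, $\mathbf{R}=\mathrm{blkdiag}(R_0,\dots,R_N)$, $\mathbf{H}=\mathrm{blkdiag}(H_0,\dots,H_N)$, and $\mathbf{L}=I_{N+1}\otimes I_s-\Sigma\otimes M$, where $\Sigma\in\mathbb{R}^{(N+1)\times(N+1)}$ has ones on the first subdiagonal and zeros elsewhere. Define $\mathbf{S}=\mathbf{L}^T\mathbf{D}^{-1}\mathbf{L}+\mathbf{H}^T\mathbf{R}^{-1}\mathbf{H}$, $$\mathcal{A}=\begin{pmatrix}\mathbf{D}&0&\mathbf{L}\\0&\mathbf{R}&\mathbf{H}\\ \mathbf{L}^T&\mathbf{H}^T&0\end{pmatrix},\qquad \mathcal{P}_{\mathcal{T}}=\begin{pmatrix}\mathbf{D}&0&\mathbf{L}\\0&\mathbf{R}&\mathbf{H}\\0&0&-\widehat{\mathbf{S}}\end{pmatrix},$$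 where $\widehat{\mathbf{S}}\in\mathbb{R}^{(N+1)s\times(N+1)s}$ is a nonsingular approximation to $\mathbf{S}$. *)

theory Defs
  imports
    "Jordan_Normal_Form.Char_Poly"
    "Jordan_Normal_Form.Gauss_Jordan_Elimination"
    "HOL-Computational_Algebra.Fundamental_Theorem_Algebra"
begin

text \<open>Matrices are those of Jordan-Normal-Form; rows, columns and blocks are indexed from 0.\<close>

definition spd_mat :: "nat \<Rightarrow> real mat \<Rightarrow> bool" where
  "spd_mat n A \<longleftrightarrow> A \<in> carrier_mat n n \<and> transpose_mat A = A \<and>
     (\<forall>v \<in> carrier_vec n. v \<noteq> 0\<^sub>v n \<longrightarrow> v \<bullet> (A *\<^sub>v v) > 0)"

text \<open>The inverse of an invertible matrix. On a singular matrix it is \<open>the None\<close>, about which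
  nothing is known.\<close>

definition mat_inv :: "'a :: field mat \<Rightarrow> 'a mat" where
  "mat_inv A = the (mat_inverse A)"

lemma mat_inv_eqI:
  assumes "A \<in> carrier_mat n n" "B \<in> carrier_mat n n" "B * A = 1\<^sub>m n"
  shows "mat_inv A = B"
proof (cases "mat_inverse A")
  case None
  have "A * B = 1\<^sub>m n"
    using assms mat_mult_left_right_inverse by blast
  then have "A \<in> Units (ring_mat TYPE('a) n ())"
    using assms unfolding Units_def ring_mat_def by auto
  with mat_inverse(1)[OF assms(1) None, where b = "()"] show ?thesis by blast
next
  case (Some C)
  note C = mat_inverse(2)[OF assms(1) Some]
  have "B * (A * C) = B * A * C"
    using C assms by (metis assoc_mult_mat)
  moreover have "B * (A * C) = B" "B * A * C = C"
    using C assms by auto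
  ultimately show ?thesis
    using Some by (simp add: mat_inv_def)
qed

definition kronecker_mat :: "'a :: times mat \<Rightarrow> 'a mat \<Rightarrow> 'a mat" where
  "kronecker_mat A B =
     mat (dim_row A * dim_row B) (dim_col A * dim_col B)
       (\<lambda>(i, j). A $$ (i div dim_row B, j div dim_col B) * B $$ (i mod dim_row B, j mod dim_col B))"

definition append_columns :: "'a :: zero mat \<Rightarrow> 'a mat \<Rightarrow> 'a mat" where
  "append_columns A B = four_block_mat A B (0\<^sub>m 0 (dim_col A)) (0\<^sub>m 0 (dim_col B))"

definition nine_block_mat ::
  "'a :: zero mat \<Rightarrow> 'a mat \<Rightarrow> 'a mat \<Rightarrow> 'a mat \<Rightarrow> 'a mat \<Rightarrow> 'a mat \<Rightarrow> 'a mat \<Rightarrow> 'a mat \<Rightarrow> 'a mat \<Rightarrow> 'a mat"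
where
  "nine_block_mat A11 A12 A13 A21 A22 A23 A31 A32 A33 =
     four_block_mat
       (four_block_mat A11 A12 A21 A22) (A13 @\<^sub>r A23)
       (append_columns A31 A32)         A33"

text \<open>The eigenvalues of a real matrix are its complex ones. The multiplicity of \<open>x\<close> in
  \<open>proots q\<close> is \<open>order x q\<close>, so each eigenvalue occurs with its algebraic multiplicity.\<close>

definition eigenvalues_mset :: "real mat \<Rightarrow> complex multiset" where
  "eigenvalues_mset A = proots (char_poly (map_mat complex_of_real A))"

lemma in_eigenvalues_mset_iff:
  assumes "A \<in> carrier_mat n n"
  shows "x \<in># eigenvalues_mset A \<longleftrightarrow> eigenvalue (map_mat complex_of_real A) x"
proof -
  have A: "map_mat complex_of_real A \<in> carrier_mat n n"
    using assms by simp
  have "char_poly (map_mat complex_of_real A) \<noteq> 0"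
    using degree_monic_char_poly[OF A] by auto
  then show ?thesis
    by (simp add: eigenvalues_mset_def eigenvalue_root_char_poly[OF A])
qed

lemma size_eigenvalues_mset:
  assumes "A \<in> carrier_mat n n"
  shows "size (eigenvalues_mset A) = n"
  using assms degree_monic_char_poly[of "map_mat complex_of_real A" n]
  by (simp add: eigenvalues_mset_def size_proots_complex)

definition D_mat :: "nat \<Rightarrow> real mat \<Rightarrow> (nat \<Rightarrow> real mat) \<Rightarrow> real mat" where
  "D_mat N B Q = diag_block_mat (B # map Q [1..<N + 1])"

definition R_mat :: "nat \<Rightarrow> (nat \<Rightarrow> real mat) \<Rightarrow> real mat" where
  "R_mat N R = diag_block_mat (map R [0..<N + 1])"

definition H_mat :: "nat \<Rightarrow> (nat \<Rightarrow> real mat) \<Rightarrow> real mat" where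
  "H_mat N H = diag_block_mat (map H [0..<N + 1])"

definition Sigma_mat :: "nat \<Rightarrow> real mat" where
  "Sigma_mat N = mat (N + 1) (N + 1) (\<lambda>(i, j). if i = j + 1 then 1 else 0)"

definition L_mat :: "nat \<Rightarrow> nat \<Rightarrow> real mat \<Rightarrow> real mat" where
  "L_mat N s M = kronecker_mat (1\<^sub>m (N + 1)) (1\<^sub>m s) - kronecker_mat (Sigma_mat N) M"

definition S_mat :: "real mat \<Rightarrow> real mat \<Rightarrow> real mat \<Rightarrow> real mat \<Rightarrow> real mat" where
  "S_mat D R L H =
     transpose_mat L * mat_inv D * L + transpose_mat H * mat_inv R * H"

definition A_mat :: "real mat \<Rightarrow> real mat \<Rightarrow> real mat \<Rightarrow> real mat \<Rightarrow> real mat" where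
  "A_mat D R L H =
     (let m = dim_row D; q = dim_row R in
      nine_block_mat
        D               (0\<^sub>m m q)       L
        (0\<^sub>m q m)        R               H
        (transpose_mat L) (transpose_mat H) (0\<^sub>m m m))"

definition PT_mat :: "real mat \<Rightarrow> real mat \<Rightarrow> real mat \<Rightarrow> real mat \<Rightarrow> real mat \<Rightarrow> real mat" where
  "PT_mat D R L H Shat =
     (let m = dim_row D; q = dim_row R in
      nine_block_mat
        D         (0\<^sub>m m q) L
        (0\<^sub>m q m) R         H
        (0\<^sub>m m m) (0\<^sub>m m q) (- Shat))"

end

theory Submission
  imports Defs
begin

text \<open>
  Write \<open>K = blkdiag(D, R)\<close> and \<open>G = (L; H)\<close>, so that \<open>S = G\<^sup>T K\<^sup>-\<^sup>1 G\<close>. Block elimination gives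
  \<open>A = X P\<^sub>T\<close>, where \<open>X\<close> is block lower triangular with diagonal blocks \<open>I\<close> and \<open>S Shat\<^sup>-\<^sup>1\<close>. Hence
  \<open>P\<^sub>T\<^sup>-\<^sup>1 A = P\<^sub>T\<^sup>-\<^sup>1 X P\<^sub>T\<close> is similar to \<open>X\<close>, whose characteristic polynomial can be read off.
\<close>

section \<open>Inverses and nonvanishing determinants\<close>

lemma mat_inv_det_nonzero:
  fixes A :: "'a :: field mat"
  assumes A: "A \<in> carrier_mat n n" and "det A \<noteq> 0"
  shows "mat_inv A \<in> carrier_mat n n" "A * mat_inv A = 1\<^sub>m n" "mat_inv A * A = 1\<^sub>m n"
proof -
  \<comment> \<open>A nonzero determinant makes \<open>A\<close> a unit of the matrix ring, which
    rules out the result \<open>None\<close>, so \<open>the\<close> in \<open>mat_inv\<close> is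
    applied to a genuine inverse.\<close>
  have "A \<in> Units (ring_mat TYPE('a) n ())"
    by (rule det_non_zero_imp_unit[OF assms])
  then have "mat_inverse A \<noteq> None"
    using mat_inverse(1)[OF A, where b = "()"] by blast
  then have "mat_inverse A = Some (mat_inv A)"
    by (simp add: mat_inv_def)
  from mat_inverse(2)[OF A this]
  show "mat_inv A \<in> carrier_mat n n" "A * mat_inv A = 1\<^sub>m n" "mat_inv A * A = 1\<^sub>m n"
    by blast+
qed

lemma det_nonzero_if_invertible_mat:
  fixes A :: "'a :: field mat"
  assumes A: "A \<in> carrier_mat n n" and "invertible_mat A"
  shows "det A \<noteq> 0"
proof -
  obtain B where AB: "A * B = 1\<^sub>m n" and BA: "B * A = 1\<^sub>m (dim_row B)"
    using assms unfolding invertible_mat_def inverts_mat_def by auto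
  \<comment> \<open>\<open>invertible_mat\<close> leaves the shape of \<open>B\<close> open.
    Comparing column counts in \<open>AB\<close> gives its width, and in \<open>BA\<close> its
    height.\<close>
  have "dim_col B = n" "dim_row B = n"
    using arg_cong[OF AB, of dim_col] arg_cong[OF BA, of dim_col] A by simp_all
  then have B: "B \<in> carrier_mat n n" by blast
  have "det A * det B = 1"
    using det_mult[OF A B] AB by simp
  then show ?thesis by auto
qed

text \<open>A nonzero kernel vector would make the quadratic form vanish, against
  definiteness.\<close>

lemma spd_mat_det_nonzero:
  assumes "spd_mat n A"
  shows "det A \<noteq> 0"
proof
  have A: "A \<in> carrier_mat n n" using assms by (simp add: spd_mat_def)
  assume "det A = 0"
  then obtain v where v: "v \<in> carrier_vec n" "v \<noteq> 0\<^sub>v n" "A *\<^sub>v v = 0\<^sub>v n"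
    using det_0_iff_vec_prod_zero_field[OF A] by blast
  then have "v \<bullet> (A *\<^sub>v v) = 0" by simp
  with v assms show False unfolding spd_mat_def by force
qed

section \<open>Block diagonal matrices with blocks of equal size\<close>

lemma diag_block_mat_carrier:
  assumes "\<And>A. A \<in> set As \<Longrightarrow> A \<in> carrier_mat nr nc"
  shows "diag_block_mat As \<in> carrier_mat (length As * nr) (length As * nc)"
  using assms
proof (induction As)
  case Nil
  show ?case by simp
next
  case (Cons A As)
  have A: "A \<in> carrier_mat nr nc"
    and As: "diag_block_mat As \<in> carrier_mat (length As * nr) (length As * nc)"
    using Cons by auto
  show ?case
    using four_block_carrier_mat[OF A As] by (simp add: Let_def)
qed

text \<open>The determinant is the product of those of the blocks, by peeling off the first block as
  a block triangular matrix. It supplies the nonsingularity of \<open>DD\<close> and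
  \<open>RR\<close>.\<close>

lemma det_diag_block_mat_nonzero:
  fixes As :: "'a :: idom mat list"
  assumes "\<And>A. A \<in> set As \<Longrightarrow> A \<in> carrier_mat n n \<and> det A \<noteq> 0"
  shows "det (diag_block_mat As) \<noteq> 0"
  using assms
proof (induction As)
  case Nil
  show ?case by simp
next
  case (Cons A As)
  have A: "A \<in> carrier_mat n n" and As: "diag_block_mat As \<in> carrier_mat (length As * n) (length As * n)"
    using Cons.prems by (auto intro!: diag_block_mat_carrier)
  have "det (diag_block_mat (A # As)) = det A * det (diag_block_mat As)"
    using A As det_four_block_mat_lower_left_zero[OF A zero_carrier_mat refl As]
    by (simp add: Let_def)
  with Cons show ?case by simp
qed

section \<open>Characteristic polynomials of block matrices\<close>

lemma char_poly_four_block_upper_right_zero: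
  fixes A :: "'a :: idom mat"
  assumes A: "A \<in> carrier_mat n n" and C: "C \<in> carrier_mat m n" and D: "D \<in> carrier_mat m m"
  shows "char_poly (four_block_mat A (0\<^sub>m n m) C D) = char_poly A * char_poly D"
proof -
  \<comment> \<open>Subtracting from \<open>x\<close> times the identity keeps the block triangular
    shape: the indeterminate enters only the diagonal blocks, and \<open>C\<close> becomes a block
    of constants.\<close>
  have "char_poly_matrix (four_block_mat A (0\<^sub>m n m) C D) =
      four_block_mat (char_poly_matrix A) (0\<^sub>m n m) (map_mat (\<lambda>a. [:- a:]) C) (char_poly_matrix D)"
    using assms by (intro eq_matI) (auto simp: char_poly_matrix_def)
  then show ?thesis
    unfolding char_poly_def
    using det_four_block_mat_upper_right_zero[OF char_poly_matrix_closed[OF A] refl _ char_poly_matrix_closed[OF D]] C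
    by simp
qed

lemma char_poly_one_mat: "char_poly (1\<^sub>m n :: 'a :: idom mat) = [:- 1, 1:] ^ n"
proof -
  have "upper_triangular (1\<^sub>m n :: 'a mat)" by auto
  moreover have "diag_mat (1\<^sub>m n :: 'a mat) = replicate n 1"
    by (intro nth_equalityI) (auto simp: diag_mat_def)
  ultimately show ?thesis
    by (simp add: char_poly_upper_triangular[OF one_carrier_mat] prod_list_replicate)
qed

text \<open>The linear algebra core, in two-by-two block form. It needs only that \<open>K\<close>
  and \<open>T\<close> be nonsingular; \<open>W\<close> need not be the transpose of
  \<open>G\<close>, nor \<open>K\<close> symmetric.\<close>

lemma char_poly_block_triangular_preconditioner:
  fixes K :: "'a :: field mat"
  assumes K: "K \<in> carrier_mat n n" "det K \<noteq> 0" and T: "T \<in> carrier_mat m m" "det T \<noteq> 0"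
    and G: "G \<in> carrier_mat n m" and W: "W \<in> carrier_mat m n"
  defines "P \<equiv> four_block_mat K G (0\<^sub>m m n) (- T)"
    and "A \<equiv> four_block_mat K G W (0\<^sub>m m m)"
  shows "char_poly (mat_inv P * A) =
    [:- 1, 1:] ^ n * char_poly (W * mat_inv K * G * mat_inv T)"
proof -
  note Ki = mat_inv_det_nonzero[OF K] and Ti = mat_inv_det_nonzero[OF T]
  define S where "S = W * mat_inv K * G"
  have S: "S \<in> carrier_mat m m" using W Ki(1) G by (auto simp: S_def)
  \<comment> \<open>Solving \<open>X * P = A\<close> blockwise forces this \<open>X\<close>: the
    common first block row gives the identity and zero, the first column gives
    \<open>W * mat_inv K\<close>, and the zero corner of \<open>A\<close> then requires the last
    block times \<open>T\<close> to equal \<open>S\<close>. The minus sign in \<open>P\<close> makes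
    that block \<open>S * mat_inv T\<close> rather than its negative.\<close>
  define X where "X = four_block_mat (1\<^sub>m n) (0\<^sub>m n m) (W * mat_inv K) (S * mat_inv T)"
  have P: "P \<in> carrier_mat (n + m) (n + m)" and X: "X \<in> carrier_mat (n + m) (n + m)"
    using K(1) T(1) S Ti(1) by (auto simp: P_def X_def)
  \<comment> \<open>As a scalar multiple, \<open>- T\<close> has determinant \<open>det T\<close> up
    to sign.\<close>
  have "- T = (- 1) \<cdot>\<^sub>m T" by (intro eq_matI) auto
  then have "det (- T) \<noteq> 0" using T by simp
  then have "det P \<noteq> 0"
    unfolding P_def using K T G by (subst det_four_block_mat_lower_left_zero) auto
  note Pi = mat_inv_det_nonzero[OF P this]
  have WK: "W * mat_inv K \<in> carrier_mat m n" and ST: "S * mat_inv T \<in> carrier_mat m m"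
    using W Ki(1) S Ti(1) by auto
  have XP: "X * P = four_block_mat (1\<^sub>m n * K + 0\<^sub>m n m * 0\<^sub>m m n) (1\<^sub>m n * G + 0\<^sub>m n m * (- T))
      (W * mat_inv K * K + S * mat_inv T * 0\<^sub>m m n) (W * mat_inv K * G + S * mat_inv T * (- T))"
    unfolding X_def P_def using K(1) G WK ST T(1) by (intro mult_four_block_mat) auto
  have "W * mat_inv K * K = W"
    using assoc_mult_mat[OF W Ki(1) K(1)] Ki(3) W by simp
  then have block21: "W * mat_inv K * K + S * mat_inv T * 0\<^sub>m m n = W"
    using right_mult_zero_mat[OF ST] right_add_zero_mat[OF W] by simp
  have "S * mat_inv T * T = S"
    using assoc_mult_mat[OF S Ti(1) T(1)] Ti(3) S by simp
  moreover have "dim_col (S * mat_inv T) = dim_row T"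
    using carrier_matD[OF ST] carrier_matD[OF T(1)] by simp
  ultimately have "S * mat_inv T * (- T) = - S"
    by (simp only: uminus_mult_right_mat)
  then have block22: "W * mat_inv K * G + S * mat_inv T * (- T) = 0\<^sub>m m m"
    using add_uminus_minus_mat[OF S S] minus_r_inv_mat[OF S] unfolding S_def[symmetric] by simp
  have nT: "- T \<in> carrier_mat m m" using T(1) by simp
  have "X * P = A"
    unfolding XP block21 block22 A_def
    by (simp only: left_mult_one_mat[OF K(1)] left_mult_one_mat[OF G]
        left_mult_zero_mat[OF zero_carrier_mat] left_mult_zero_mat[OF nT]
        right_add_zero_mat[OF K(1)] right_add_zero_mat[OF G])
  then have "mat_inv P * A = mat_inv P * X * P"
    by (simp only: assoc_mult_mat[OF Pi(1) X P])
  \<comment> \<open>The conjugating matrices are \<open>mat_inv P\<close> and \<open>P\<close>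
    themselves.\<close>
  then have "similar_mat (mat_inv P * A) X"
    using Pi(1) X P by (intro similar_matI[OF _ Pi(3) Pi(2)]) auto
  then have "char_poly (mat_inv P * A) = char_poly X" by (rule char_poly_similar)
  also have "\<dots> = [:- 1, 1:] ^ n * char_poly (S * mat_inv T)"
    unfolding X_def
    using char_poly_four_block_upper_right_zero[OF one_carrier_mat WK ST]
    by (simp add: char_poly_one_mat)
  finally show ?thesis unfolding S_def .
qed

section \<open>Passing between the two-by-two and three-by-three block forms\<close>

lemma mat_inv_block_diag:
  fixes A :: "'a :: field mat"
  assumes A: "A \<in> carrier_mat n n" "det A \<noteq> 0" and D: "D \<in> carrier_mat m m" "det D \<noteq> 0"
  shows "mat_inv (four_block_mat A (0\<^sub>m n m) (0\<^sub>m m n) D) =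
    four_block_mat (mat_inv A) (0\<^sub>m n m) (0\<^sub>m m n) (mat_inv D)"
proof (rule mat_inv_eqI)
  note Ai = mat_inv_det_nonzero[OF A] and Di = mat_inv_det_nonzero[OF D]
  show "four_block_mat A (0\<^sub>m n m) (0\<^sub>m m n) D \<in> carrier_mat (n + m) (n + m)"
    "four_block_mat (mat_inv A) (0\<^sub>m n m) (0\<^sub>m m n) (mat_inv D) \<in> carrier_mat (n + m) (n + m)"
    using A D Ai Di by auto
  show "four_block_mat (mat_inv A) (0\<^sub>m n m) (0\<^sub>m m n) (mat_inv D) *
      four_block_mat A (0\<^sub>m n m) (0\<^sub>m m n) D = 1\<^sub>m (n + m)"
    using A D Ai Di by (subst mult_four_block_mat) auto
qed

text \<open>With transposes on the left and inverses in the middle, this yields the two summands of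
  \<open>S_mat\<close>.\<close>

lemma append_columns_block_diag_append_rows:
  fixes A1 :: "'a :: comm_ring_1 mat"
  assumes A: "A1 \<in> carrier_mat k n" "A2 \<in> carrier_mat k m"
    and B: "B1 \<in> carrier_mat n n" "B2 \<in> carrier_mat m m"
    and C: "C1 \<in> carrier_mat n l" "C2 \<in> carrier_mat m l"
  shows "append_columns A1 A2 * four_block_mat B1 (0\<^sub>m n m) (0\<^sub>m m n) B2 * (C1 @\<^sub>r C2) =
    A1 * B1 * C1 + A2 * B2 * C2"
proof -
  have AB: "A1 * B1 \<in> carrier_mat k n" "A2 * B2 \<in> carrier_mat k m"
    using A B by auto
  have "append_columns A1 A2 * four_block_mat B1 (0\<^sub>m n m) (0\<^sub>m m n) B2 =
      four_block_mat (A1 * B1) (A2 * B2) (0\<^sub>m 0 n) (0\<^sub>m 0 m)"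
    unfolding append_columns_def using A B
    \<comment> \<open>A block row is a four-block matrix whose lower blocks have height 0, so the
      usual product rule applies.\<close>
    by (subst mult_four_block_mat[of _ k n _ m _ 0]) auto
  then have "append_columns A1 A2 * four_block_mat B1 (0\<^sub>m n m) (0\<^sub>m m n) B2 * (C1 @\<^sub>r C2) =
      four_block_mat (A1 * B1 * C1 + A2 * B2 * C2) (0\<^sub>m k 0) (0\<^sub>m 0 l) (0\<^sub>m 0 0)"
    unfolding append_rows_def using AB C
    by (simp, subst mult_four_block_mat[of _ k n _ m _ 0 _ _ l _ 0]) auto
  also have "\<dots> = A1 * B1 * C1 + A2 * B2 * C2"
    using AB C by (intro eq_matI) auto
  finally show ?thesis .
qed

text \<open>The real factorization survives the embedding into the complex numbers, a ring
  homomorphism, and roots with multiplicity add up over products.\<close>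

lemma eigenvalues_mset_eqI:
  assumes A: "A \<in> carrier_mat k k" and B: "B \<in> carrier_mat m m"
    and eq: "char_poly A = [:- 1, 1:] ^ n * char_poly B"
  shows "eigenvalues_mset A = replicate_mset n 1 + eigenvalues_mset B"
proof -
  interpret cp: map_poly_comm_ring_hom complex_of_real ..
  have "char_poly (map_mat complex_of_real A) =
      [:- 1, 1:] ^ n * char_poly (map_mat complex_of_real B)"
    unfolding of_real_hom.char_poly_hom[OF A] of_real_hom.char_poly_hom[OF B] eq
    by (simp add: cp.hom_mult cp.hom_power map_poly_pCons)
  \<comment> \<open>\<open>proots\<close> splits over a product only when both factors are nonzero;
    here monicity ensures it.\<close>
  moreover have "char_poly (map_mat complex_of_real B) \<noteq> 0"
    using degree_monic_char_poly[of "map_mat complex_of_real B" m] B by auto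
  moreover have "repeat_mset n {#1 :: complex#} = replicate_mset n 1"
    by (rule multiset_eqI) simp
  ultimately show ?thesis
    by (simp add: eigenvalues_mset_def proots_mult proots_power)
qed

theorem proposition9:
  fixes N s p :: nat
    and B M Shat DD RR HH LL SS :: "real mat"
    and Q R H :: "nat \<Rightarrow> real mat"
  assumes "N \<ge> 1" and "s \<ge> 1" and "p \<ge> 1"
    and "spd_mat s B"
    and "\<And>i. 1 \<le> i \<Longrightarrow> i \<le> N \<Longrightarrow> spd_mat s (Q i)"
    and "\<And>i. i \<le> N \<Longrightarrow> spd_mat p (R i)"
    and "\<And>i. i \<le> N \<Longrightarrow> H i \<in> carrier_mat p s"
    and "M \<in> carrier_mat s s"
    and "DD = D_mat N B Q" and "RR = R_mat N R"
    and "HH = H_mat N H" and "LL = L_mat N s M"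
    and "SS = S_mat DD RR LL HH"
    and "Shat \<in> carrier_mat ((N + 1) * s) ((N + 1) * s)" and "invertible_mat Shat"
  shows "eigenvalues_mset (mat_inv (PT_mat DD RR LL HH Shat) * A_mat DD RR LL HH) =
           replicate_mset ((s + p) * (N + 1)) 1 + eigenvalues_mset (SS * mat_inv Shat)"
proof -
  note DD = assms(9) and RR = assms(10) and HH = assms(11) and LL = assms(12) and SS = assms(13)
    and T = assms(14) and invT = assms(15)
  define m q where "m = (N + 1) * s" and "q = (N + 1) * p"
  note T = T[folded m_def]
  have detT: "det Shat \<noteq> 0" using det_nonzero_if_invertible_mat T invT by blast
  have blocksD: "A \<in> carrier_mat s s \<and> det A \<noteq> 0" if "A \<in> set (B # map Q [1..<N + 1])" for A
  proof -
    have "spd_mat s A" using that assms(4,5) by (auto simp: less_Suc_eq_le)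
    then show ?thesis using spd_mat_det_nonzero by (auto simp: spd_mat_def)
  qed
  have blocksR: "A \<in> carrier_mat p p \<and> det A \<noteq> 0" if "A \<in> set (map R [0..<N + 1])" for A
  proof -
    have "spd_mat p A" using that assms(6) by (auto simp: less_Suc_eq_le)
    then show ?thesis using spd_mat_det_nonzero by (auto simp: spd_mat_def)
  qed
  have D: "DD \<in> carrier_mat m m"
    \<comment> \<open>\<open>B\<close> and \<open>Q 1\<close> to \<open>Q N\<close> make
      \<open>N + 1\<close> blocks. The list stays folded so that its length can be
      simplified.\<close>
    using diag_block_mat_carrier[of "B # map Q [1..<N + 1]", OF conjunct1[OF blocksD]]
    unfolding DD D_mat_def m_def by (simp del: diag_block_mat.simps upt_Suc)
  have detD: "det DD \<noteq> 0"
    unfolding DD D_mat_def by (rule det_diag_block_mat_nonzero[OF blocksD])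
  have R: "RR \<in> carrier_mat q q"
    using diag_block_mat_carrier[of "map R [0..<N + 1]", OF conjunct1[OF blocksR]]
    unfolding RR R_mat_def q_def by (simp del: diag_block_mat.simps upt_Suc)
  have detR: "det RR \<noteq> 0"
    unfolding RR R_mat_def by (rule det_diag_block_mat_nonzero[OF blocksR])
  have blocksH: "A \<in> carrier_mat p s" if "A \<in> set (map H [0..<N + 1])" for A
    using that assms(7) by (auto simp: less_Suc_eq_le)
  have H: "HH \<in> carrier_mat q m"
    using diag_block_mat_carrier[of "map H [0..<N + 1]", OF blocksH]
    unfolding HH H_mat_def q_def m_def by (simp del: diag_block_mat.simps upt_Suc)
  have L: "LL \<in> carrier_mat m m"
    using assms(8) unfolding LL L_mat_def m_def kronecker_mat_def Sigma_mat_def by auto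
  \<comment> \<open>This grouping matches the nesting in \<open>nine_block_mat\<close>, so
    \<open>A_eq\<close> follows by unfolding.\<close>
  define K where "K = four_block_mat DD (0\<^sub>m m q) (0\<^sub>m q m) RR"
  define G where "G = LL @\<^sub>r HH"
  define W where "W = append_columns (transpose_mat LL) (transpose_mat HH)"
  have K: "K \<in> carrier_mat (m + q) (m + q)" using D R by (simp add: K_def)
  have detK: "det K \<noteq> 0"
    using D R detD detR unfolding K_def by (subst det_four_block_mat_lower_left_zero) auto
  have G: "G \<in> carrier_mat (m + q) m" using L H by (simp add: G_def)
  have W: "W \<in> carrier_mat m (m + q)" using L H by (auto simp: W_def append_columns_def)
  have A_eq: "A_mat DD RR LL HH = four_block_mat K G W (0\<^sub>m m m)"
    using D R by (simp add: A_mat_def nine_block_mat_def K_def G_def W_def)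
  have "append_columns (0\<^sub>m m m) (0\<^sub>m m q) = (0\<^sub>m m (m + q) :: real mat)"
    by (intro eq_matI) (auto simp: append_columns_def)
  then have P_eq: "PT_mat DD RR LL HH Shat = four_block_mat K G (0\<^sub>m m (m + q)) (- Shat)"
    using D R by (simp add: PT_mat_def nine_block_mat_def K_def G_def)
  have S_eq: "W * mat_inv K * G = SS"
    unfolding W_def K_def G_def SS S_mat_def mat_inv_block_diag[OF D detD R detR]
    using L H mat_inv_det_nonzero(1)[OF D detD] mat_inv_det_nonzero(1)[OF R detR]
    by (intro append_columns_block_diag_append_rows) auto
  have S: "SS \<in> carrier_mat m m"
    unfolding S_eq[symmetric] using W G mat_inv_det_nonzero(1)[OF K detK] by auto
  \<comment> \<open>The units are counted by the order of \<open>K\<close>: \<open>m\<close> from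
    \<open>DD\<close> and \<open>q\<close> from \<open>RR\<close>.\<close>
  have size: "(s + p) * (N + 1) = m + q" by (simp add: m_def q_def algebra_simps)
  show ?thesis
    unfolding size
  proof (rule eigenvalues_mset_eqI)
    have "char_poly (mat_inv (PT_mat DD RR LL HH Shat) * A_mat DD RR LL HH) =
        [:- 1, 1:] ^ (m + q) * char_poly (W * mat_inv K * G * mat_inv Shat)"
      unfolding A_eq P_eq by (rule char_poly_block_triangular_preconditioner[OF K detK T detT G W])
    then show "char_poly (mat_inv (PT_mat DD RR LL HH Shat) * A_mat DD RR LL HH) =
        [:- 1, 1:] ^ (m + q) * char_poly (SS * mat_inv Shat)"
      unfolding S_eq .
    have P: "PT_mat DD RR LL HH Shat \<in> carrier_mat (m + q + m) (m + q + m)"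
      unfolding P_eq using K T by auto
    have "- Shat = (- 1) \<cdot>\<^sub>m Shat" by (intro eq_matI) auto
    then have "det (- Shat) \<noteq> 0" using detT by simp
    then have "det (PT_mat DD RR LL HH Shat) \<noteq> 0"
      unfolding P_eq using K T G detK by (subst det_four_block_mat_lower_left_zero) auto
    from mat_inv_det_nonzero(1)[OF P this]
    show "mat_inv (PT_mat DD RR LL HH Shat) * A_mat DD RR LL HH \<in> carrier_mat (m + q + m) (m + q + m)"
      unfolding A_eq using K by auto
    show "SS * mat_inv Shat \<in> carrier_mat m m"
      using S mat_inv_det_nonzero(1)[OF T detT] by auto
  qed
qed

end
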